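(* Let $(\mathfrak{g},\langle\,,\rangle)$ be a flat pseudo-Euclidean nilpotent non-abelian Lie algebra of signature $(2,n-2)$ with $n\ge 4$ (so $n=\dim\mathfrak{g}$). Then the center $Z(\mathfrak{g})$ is degenerate, i.e. $Z(\mathfrak{g})\cap Z(\mathfrak{g})^\perp\neq\{0\}$.
   Context: A pseudo-Euclidean Lie algebra $(\mathfrak{g},\langle\,,\rangle)$ is a finite-dimensional real Lie algebra with a non-degenerate symmetric bilinear form. Its Levi-Civita product $(u,v)\mapsto u.v$ is defined by $2\langle u.v,w\rangle=\langle[u,v],w\rangle+\langle[w,u],v\rangle+\langle[w,v],u\rangle$ for all $u,v,w\in\mathfrak{g}$. Write $\mathrm{L}_u v=u.v$. $(\mathfrak{g},\langle\,,\rangle)$ is flat if the Levi-Civita product is left symmetric: $(u.v).w-u.(v.w)=(v.u).w-v.(u.w)$ for all $u,v,w$; equivalently $\mathrm{L}_{[u,v]}=[\mathrm{L}_u,\mathrm{L}_v]$ for all $u,v$. Signature $(p,q)$ means $p$ negative and $q$ positive directions. $Z(\mathfrak{g})$ is the center, $\perp$ denotes the orthogonal with respect to $\langle\,,\rangle$, and a subspace $F$ is degenerate if $F\cap F^\perp\ne\{0\}$. *)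

theory Defs
  imports "HOL-Analysis.Analysis"
begin

section \<open>Real Lie algebras\<close>

text \<open>A Lie algebra has as its underlying vector space a whole type of class
  \<^class>\<open>real_vector\<close>. The Lie bracket and the scalar product are variables.
  No inner product or norm on the type is used.\<close>

definition finite_dim :: "'a::real_vector itself \<Rightarrow> bool" where
  "finite_dim _ \<longleftrightarrow> (\<exists>B::'a set. finite B \<and> span B = UNIV)"

locale real_lie_algebra =
  fixes br :: "'a::real_vector \<Rightarrow> 'a \<Rightarrow> 'a"
  assumes bilinear_br: "bilinear br"
    and alternating: "br u u = 0"
    and jacobi: "br u (br v w) + br v (br w u) + br w (br u v) = 0"

definition lie_center :: "('a::real_vector \<Rightarrow> 'a \<Rightarrow> 'a) \<Rightarrow> 'a set" where
  "lie_center br = {z. \<forall>u. br z u = 0}"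

definition lie_abelian :: "('a::real_vector \<Rightarrow> 'a \<Rightarrow> 'a) \<Rightarrow> bool" where
  "lie_abelian br \<longleftrightarrow> (\<forall>u v. br u v = 0)"

primrec lower_central_series :: "('a::real_vector \<Rightarrow> 'a \<Rightarrow> 'a) \<Rightarrow> nat \<Rightarrow> 'a set" where
  "lower_central_series br 0 = UNIV"
| "lower_central_series br (Suc k) = span {br u v | u v. v \<in> lower_central_series br k}"

definition lie_nilpotent :: "('a::real_vector \<Rightarrow> 'a \<Rightarrow> 'a) \<Rightarrow> bool" where
  "lie_nilpotent br \<longleftrightarrow> (\<exists>k. lower_central_series br k = {0})"


section \<open>Scalar products\<close>

definition nondegenerate :: "('a::real_vector \<Rightarrow> 'a \<Rightarrow> real) \<Rightarrow> bool" where
  "nondegenerate form \<longleftrightarrow> (\<forall>u. (\<forall>v. form u v = 0) \<longrightarrow> u = 0)"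

definition form_perp :: "('a::real_vector \<Rightarrow> 'a \<Rightarrow> real) \<Rightarrow> 'a set \<Rightarrow> 'a set" where
  "form_perp form F = {u. \<forall>v\<in>F. form u v = 0}"

definition degenerate_subspace :: "('a::real_vector \<Rightarrow> 'a \<Rightarrow> real) \<Rightarrow> 'a set \<Rightarrow> bool" where
  "degenerate_subspace form F \<longleftrightarrow> F \<inter> form_perp form F \<noteq> {0}"

text \<open>Signature \<open>(p, q)\<close>: there is an orthogonal basis with \<open>p\<close> vectors of square \<open>-1\<close>
  and \<open>q\<close> vectors of square \<open>1\<close>. The negative directions are counted first.\<close>

definition has_signature :: "('a::real_vector \<Rightarrow> 'a \<Rightarrow> real) \<Rightarrow> nat \<Rightarrow> nat \<Rightarrow> bool" where
  "has_signature form p q \<longleftrightarrow>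
    (\<exists>N P. finite N \<and> finite P \<and> N \<inter> P = {} \<and> card N = p \<and> card P = q \<and>
      independent (N \<union> P) \<and> span (N \<union> P) = UNIV \<and>
      (\<forall>b\<in>N. form b b = -1) \<and> (\<forall>b\<in>P. form b b = 1) \<and>
      (\<forall>b\<in>N \<union> P. \<forall>c\<in>N \<union> P. b \<noteq> c \<longrightarrow> form b c = 0))"


section \<open>Pseudo-Euclidean Lie algebras\<close>

locale pseudo_euclidean_lie_algebra = real_lie_algebra br
  for br :: "'a::real_vector \<Rightarrow> 'a \<Rightarrow> 'a" +
  fixes form :: "'a \<Rightarrow> 'a \<Rightarrow> real"
  assumes finite_dim: "finite_dim TYPE('a)"
    and bilinear_form: "bilinear form"
    and sym_form: "form u v = form v u"
    and nondegenerate_form: "nondegenerate form"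

definition levi_civita ::
    "('a::real_vector \<Rightarrow> 'a \<Rightarrow> 'a) \<Rightarrow> ('a \<Rightarrow> 'a \<Rightarrow> real) \<Rightarrow> 'a \<Rightarrow> 'a \<Rightarrow> 'a" where
  "levi_civita br form u v =
    (THE z. \<forall>w. 2 * form z w = form (br u v) w + form (br w u) v + form (br w v) u)"

definition flat :: "('a::real_vector \<Rightarrow> 'a \<Rightarrow> 'a) \<Rightarrow> ('a \<Rightarrow> 'a \<Rightarrow> real) \<Rightarrow> bool" where
  "flat br form \<longleftrightarrow> (let m = levi_civita br form in
    \<forall>u v w. m (m u v) w - m u (m v w) = m (m v u) w - m v (m u w))"

text \<open>The definite description in \<^const>\<open>levi_civita\<close> is meaningful: the form represents
  every linear functional by a unique vector.\<close>

context pseudo_euclidean_lie_algebra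
begin

lemma form_represents:
  fixes f :: "'a \<Rightarrow> real"
  assumes f: "linear f"
  shows "\<exists>!z. \<forall>w. form z w = f w"
proof -
  have lin1: "linear (\<lambda>u. form u w)" and lin2: "linear (form u)" for u w
    using bilinear_form by (auto simp: bilinear_def)
  obtain C :: "'a set" where C: "finite C" "span C = UNIV"
    using finite_dim unfolding finite_dim_def by blast
  obtain B where B: "B \<subseteq> C" "independent B" "C \<subseteq> span B"
    using maximal_independent_subset[of C] by metis
  have finB: "finite B" using B(1) C(1) finite_subset by blast
  have spB: "span B = UNIV"
    using B(3) C(2) span_minimal subspace_span by (metis top.extremum_uniqueI)
  interpret fd: finite_dimensional_vector_space "scaleR :: real \<Rightarrow> 'a \<Rightarrow> 'a" B
    using finB B(2) spB
    by unfold_locales (auto simp: dependent_raw_def span_raw_def)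
  define T where "T u = (\<Sum>b\<in>B. form u b *\<^sub>R b)" for u
  have coeffs: "\<forall>b\<in>B. g b = h b"
    if "(\<Sum>b\<in>B. g b *\<^sub>R b) = (\<Sum>b\<in>B. h b *\<^sub>R b)" for g h :: "'a \<Rightarrow> real"
  proof -
    have "(\<Sum>b\<in>B. (g b - h b) *\<^sub>R b) = 0"
      using that by (simp add: scaleR_diff_left sum_subtractf)
    then show ?thesis
      using independentD[OF B(2) finB subset_refl, of "\<lambda>b. g b - h b"] by auto
  qed
  have ext: "\<forall>w. g w = h w" if "linear g" "linear h" "\<forall>b\<in>B. g b = h b"
    for g h :: "'a \<Rightarrow> real"
    using linear_eq_on_span[OF that(1,2)] that(3) spB by blast
  have inj0: "z = z'" if "\<forall>w. form z w = form z' w" for z z'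
  proof -
    have "\<forall>w. form (z - z') w = 0"
      using that linear_diff[OF lin1] by simp
    then show ?thesis using nondegenerate_form unfolding nondegenerate_def by force
  qed
  have linT: "linear T"
    unfolding T_def
    by (rule linearI)
      (simp_all add: linear_add[OF lin1] linear_scale[OF lin1] scaleR_add_left sum.distrib
        scaleR_sum_right)
  have "inj T"
    using coeffs inj0 ext[OF lin2 lin2] unfolding T_def inj_def by metis
  then have "surj T"
    using fd.linear_inj_imp_surj linT unfolding linear_def by blast
  then obtain z where "T z = (\<Sum>b\<in>B. f b *\<^sub>R b)" by (metis surjD)
  then have "\<forall>b\<in>B. form z b = f b" unfolding T_def by (rule coeffs)
  then have "\<forall>w. form z w = f w" by (rule ext[OF lin2 f])
  then show ?thesis using inj0 by metis
qed

lemma levi_civita_eq: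
  "2 * form (levi_civita br form u v) w =
     form (br u v) w + form (br w u) v + form (br w v) u"
proof -
  define f where "f w = (form (br u v) w + form (br w u) v + form (br w v) u) / 2" for w
  have "linear f"
    unfolding f_def
    by (rule linearI)
      (simp_all add: bilinear_ladd[OF bilinear_form] bilinear_radd[OF bilinear_form]
        bilinear_lmul[OF bilinear_form] bilinear_rmul[OF bilinear_form]
        bilinear_ladd[OF bilinear_br] bilinear_lmul[OF bilinear_br] field_simps)
  from form_represents[OF this]
  have "\<exists>!z. \<forall>w. 2 * form z w = form (br u v) w + form (br w u) v + form (br w v) u"
    by (simp add: f_def field_simps)
  from theI'[OF this] show ?thesis unfolding levi_civita_def by blast
qed

end

end

theory Submission
  imports Defs
begin

text \<open>
  Write \<open>z \<cdot> u\<close> for the Levi-Civita product. Two central elements have product \<open>0\<close>. If every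
  central \<open>z\<close> satisfies \<open>z \<cdot> u = 0\<close> for all \<open>u\<close>, then all brackets are orthogonal to the center, and
  the last nonzero term of the lower central series is a central subspace made of sums of brackets:
  the center meets its orthogonal.

  Otherwise fix a central \<open>z\<close> whose left multiplication does not vanish. Left multiplication by
  \<open>z\<close> is skew, has square zero and commutes with every left multiplication, so its image \<open>W\<close> is
  isotropic, orthogonal to the center and stable under all left multiplications. Since there are two
  negative directions and the rank of a skew operator is even, \<open>dim W = 2\<close>. The theorem follows once
  \<open>W\<close> is shown to contain a nonzero central vector.

  \<^item> Every left multiplication is nilpotent on \<open>W\<close> (\<open>product_square_zero_on_W\<close>). On \<open>W\<close> it lies in
    \<open>sl\<^sub>2\<close>, so it would otherwise be invertible, and then the 1-cocycle \<open>y \<mapsto> z \<cdot> y\<close> with values in \<open>W\<close>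
    would be a coboundary \<open>y \<mapsto> y \<cdot> p\<close>. This yields an element whose adjoint operator has
    eigenvalue \<open>-2\<close>. Hence, by Engel's theorem in dimension two, \<open>W\<close> contains a line that
    all left multiplications kill (\<open>right_annihilator_in_W\<close>).

  \<^item> With \<open>K\<close> the orthogonal of \<open>W\<close>, all products of \<open>W\<close> with \<open>K\<close> lie in \<open>W\<close>
    (\<open>product_W_K\<close>), because a nilpotent skew operator on the definite space \<open>K / W\<close> vanishes. So \<open>K\<close>
    acts nilpotently on \<open>W\<close> by the adjoint representation and kills a line there. Comparing the two
    lines produces a nonzero \<open>g\<close> in \<open>W\<close> with \<open>g \<cdot> K = 0\<close> (\<open>annihilates_K_in_W\<close>).

  \<^item> Such a \<open>g\<close> acts on the left as a multiple of \<open>z\<close>, for skew operators that vanish on the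
    codimension-two space \<open>K\<close> are proportional. Then all \<open>[g, x]\<close> lie in \<open>W\<close> and have zero left
    multiplication. Either \<open>g\<close> is central, or some \<open>[g, x]\<close> is nonzero and a central vector is
    obtained from it by at most one more left multiplication (\<open>central_vector_in_W\<close>).
\<close>


section \<open>Nilpotent operators on a plane\<close>

text \<open>For a subspace \<open>W\<close>, this says that its dimension is at most two. The form chosen here avoids
  bases and is what isotropy provides directly.\<close>

definition planar :: "'a::real_vector set \<Rightarrow> bool" where
  "planar W \<longleftrightarrow>
    (\<forall>u\<in>W. \<forall>v\<in>W. u \<noteq> 0 \<longrightarrow> (\<forall>c. v \<noteq> c *\<^sub>R u) \<longrightarrow>
      (\<forall>w\<in>W. \<exists>\<alpha> \<beta>. w = \<alpha> *\<^sub>R u + \<beta> *\<^sub>R v))"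

lemma planar_combination:
  assumes "planar W" "u \<in> W" "v \<in> W" "u \<noteq> 0" "\<And>c. v \<noteq> c *\<^sub>R u" "w \<in> W"
  obtains \<alpha> \<beta> where "w = \<alpha> *\<^sub>R u + \<beta> *\<^sub>R v"
  using assms unfolding planar_def by blast

text \<open>If \<open>T\<^sup>2\<close> did not vanish at \<open>u\<close>, the last three nonzero iterates of \<open>T\<close> along \<open>u\<close> would be
  linearly independent.\<close>

lemma nilpotent_on_plane_square_zero:
  assumes W: "planar W" and T: "linear T" and TW: "\<And>u. u \<in> W \<Longrightarrow> T u \<in> W"
    and nil: "(T ^^ k) u = 0" and u: "u \<in> W"
  shows "T (T u) = 0"
proof (rule ccontr)
  assume neq: "T (T u) \<noteq> 0"
  define l where "l = (LEAST k. (T ^^ k) u = 0)"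
  have l0: "(T ^^ l) u = 0" unfolding l_def by (rule LeastI) (rule nil)
  have lmin: "(T ^^ i) u \<noteq> 0" if "i < l" for i
    using that not_less_Least unfolding l_def by blast
  have T0: "T 0 = 0" by (rule linear_0[OF T])
  have "l \<noteq> 0" "l \<noteq> Suc 0" "l \<noteq> Suc (Suc 0)"
    by (rule notI, use l0 neq T0 in simp)+
  then obtain j where j: "l = Suc (Suc (Suc j))" by (metis not0_implies_Suc)
  define x where "x = (T ^^ j) u"
  have "x \<in> W" unfolding x_def by (induction j) (auto simp: u TW)
  have 3: "T (T (T x)) = 0" using l0 by (simp add: j x_def)
  have 2: "T (T x) \<noteq> 0" using lmin[of "Suc (Suc j)"] by (simp add: j x_def)
  have "T x \<noteq> c *\<^sub>R T (T x)" for c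
    using 2 3 linear_scale[OF T] by (metis scaleR_zero_right)
  then obtain \<alpha> \<beta> where "x = \<alpha> *\<^sub>R T (T x) + \<beta> *\<^sub>R T x"
    using planar_combination[OF W, of "T (T x)" "T x" x] 2 TW \<open>x \<in> W\<close> by metis
  then have "T (T x) = T (T (\<alpha> *\<^sub>R T (T x) + \<beta> *\<^sub>R T x))" by simp
  also have "\<dots> = 0" by (simp add: linear_add[OF T] linear_scale[OF T] 3 T0)
  finally show False using 2 by simp
qed

text \<open>Engel's theorem in dimension two. Polarizing the hypothesis on squares gives
  \<open>T\<^sub>x T\<^sub>y + T\<^sub>y T\<^sub>x = 0\<close>. Hence the image of any nonzero operator of the family is a line that all the
  operators kill and that contains all their images.\<close>

lemma common_kernel_on_plane:
  fixes T :: "'b::real_vector \<Rightarrow> 'a::real_vector \<Rightarrow> 'a"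
  assumes W: "planar W" and w0: "w0 \<in> W" "w0 \<noteq> 0"
    and X: "\<And>x y. x \<in> X \<Longrightarrow> y \<in> X \<Longrightarrow> x + y \<in> X"
    and T: "bilinear T"
    and TW: "\<And>x u. x \<in> X \<Longrightarrow> u \<in> W \<Longrightarrow> T x u \<in> W"
    and sq: "\<And>x u. x \<in> X \<Longrightarrow> u \<in> W \<Longrightarrow> T x (T x u) = 0"
  shows "\<exists>e\<in>W. e \<noteq> 0 \<and> (\<forall>x\<in>X. T x e = 0) \<and> (\<forall>x\<in>X. \<forall>u\<in>W. \<exists>c. T x u = c *\<^sub>R e)"
proof (cases "\<forall>x\<in>X. \<forall>u\<in>W. T x u = 0")
  case True
  then show ?thesis by (intro bexI[of _ w0]) (use w0 in \<open>auto intro: exI[of _ 0]\<close>)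
next
  case False
  note lin = bilinear_ladd[OF T] bilinear_radd[OF T] bilinear_rmul[OF T]
  from False obtain x0 u0 where x0: "x0 \<in> X" and u0: "u0 \<in> W" and ne: "T x0 u0 \<noteq> 0" by blast
  define e where "e = T x0 u0"
  have e: "e \<in> W" "e \<noteq> 0" "T x0 e = 0" using x0 u0 ne TW sq by (auto simp: e_def)
  have ind: "u0 \<noteq> c *\<^sub>R e" for c
    using ne e(3) by (metis bilinear_rmul[OF T] scaleR_zero_right)
  have anti: "T x (T y u) + T y (T x u) = 0" if "x \<in> X" "y \<in> X" "u \<in> W" for x y u
    using sq[OF X[OF that(1,2)] that(3)] sq[OF that(1,3)] sq[OF that(2,3)]
    by (simp add: lin add.commute)
  have Te: "T x e = 0" if x: "x \<in> X" for x
  proof -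
    obtain \<alpha> \<beta> where ab: "T x e = \<alpha> *\<^sub>R e + \<beta> *\<^sub>R u0"
      using planar_combination[OF W e(1) u0 e(2) ind] TW x e(1) by metis
    have "T x0 (T x e) = 0" using anti[OF x0 x e(1)] e(3) bilinear_rzero[OF T] by simp
    then have "\<beta> *\<^sub>R e = 0" by (simp add: ab lin e(3) flip: e_def)
    then have "\<beta> = 0" using e(2) by simp
    then have "T x (T x e) = (\<alpha> * \<alpha>) *\<^sub>R e" by (simp add: ab lin)
    then have "\<alpha> = 0" using sq[OF x e(1)] e(2) by simp
    then show ?thesis using ab \<open>\<beta> = 0\<close> by simp
  qed
  have Tu: "\<exists>c. T x u = c *\<^sub>R e" if x: "x \<in> X" and u: "u \<in> W" for x u
  proof -
    obtain \<alpha> \<beta> where ab: "T x u0 = \<alpha> *\<^sub>R e + \<beta> *\<^sub>R u0"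
      using planar_combination[OF W e(1) u0 e(2) ind] TW x u0 by metis
    have "0 = T x (T x u0)" using sq x u0 by simp
    also have "\<dots> = (\<beta> * \<alpha>) *\<^sub>R e + (\<beta> * \<beta>) *\<^sub>R u0"
      by (simp add: ab lin Te[OF x] scaleR_right_distrib)
    finally have *: "(\<beta> * \<beta>) *\<^sub>R u0 = (- \<beta> * \<alpha>) *\<^sub>R e" by (simp add: eq_neg_iff_add_eq_0 add.commute)
    have "\<beta> = 0"
    proof (rule ccontr)
      assume "\<beta> \<noteq> 0"
      then have "u0 = (1 / (\<beta> * \<beta>)) *\<^sub>R ((\<beta> * \<beta>) *\<^sub>R u0)" by simp
      also have "\<dots> = (- \<alpha> / \<beta>) *\<^sub>R e" unfolding * using \<open>\<beta> \<noteq> 0\<close> by simp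
      finally show False using ind by blast
    qed
    obtain \<gamma> \<eta> where "u = \<gamma> *\<^sub>R e + \<eta> *\<^sub>R u0"
      using planar_combination[OF W e(1) u0 e(2) ind u] by metis
    then have "T x u = (\<eta> * \<alpha>) *\<^sub>R e" by (simp add: lin Te[OF x] ab \<open>\<beta> = 0\<close>)
    then show ?thesis ..
  qed
  show ?thesis using e(1,2) Te Tu by blast
qed


section \<open>Forms with two negative directions\<close>

context pseudo_euclidean_lie_algebra
begin

lemmas form_simps =
  bilinear_ladd[OF bilinear_form] bilinear_radd[OF bilinear_form]
  bilinear_lsub[OF bilinear_form] bilinear_rsub[OF bilinear_form]
  bilinear_lneg[OF bilinear_form] bilinear_rneg[OF bilinear_form]
  bilinear_lmul[OF bilinear_form] bilinear_rmul[OF bilinear_form]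
  bilinear_lzero[OF bilinear_form] bilinear_rzero[OF bilinear_form]

lemmas br_simps =
  bilinear_ladd[OF bilinear_br] bilinear_radd[OF bilinear_br]
  bilinear_lsub[OF bilinear_br] bilinear_rsub[OF bilinear_br]
  bilinear_lneg[OF bilinear_br] bilinear_rneg[OF bilinear_br]
  bilinear_lmul[OF bilinear_br] bilinear_rmul[OF bilinear_br]
  bilinear_lzero[OF bilinear_br] bilinear_rzero[OF bilinear_br]

lemma eq_by_form:
  assumes "\<And>w. form u w = form v w"
  shows "u = v"
proof -
  have "\<forall>w. form (u - v) w = 0" using assms by (simp add: form_simps)
  then show ?thesis using nondegenerate_form unfolding nondegenerate_def by force
qed

text \<open>The orthogonal of the two negative basis vectors is positive definite.\<close>

lemma signature_two_negative_directions:
  assumes "has_signature form 2 q"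
  obtains n\<^sub>1 n\<^sub>2
  where "\<And>u. form u n\<^sub>1 = 0 \<Longrightarrow> form u n\<^sub>2 = 0 \<Longrightarrow> form u u = 0 \<Longrightarrow> u = 0"
proof -
  obtain N P where NP: "finite N" "finite P" "N \<inter> P = {}" "card N = 2"
    "span (N \<union> P) = UNIV" "\<forall>b\<in>N. form b b = -1" "\<forall>b\<in>P. form b b = 1"
    "\<forall>b\<in>N \<union> P. \<forall>c\<in>N \<union> P. b \<noteq> c \<longrightarrow> form b c = 0"
    using assms unfolding has_signature_def by (elim exE conjE) (rule that)
  obtain n\<^sub>1 n\<^sub>2 where N: "N = {n\<^sub>1, n\<^sub>2}" using NP(4) card_2_iff by metis
  have "u = 0" if u: "form u n\<^sub>1 = 0" "form u n\<^sub>2 = 0" "form u u = 0" for u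
  proof -
    have lin: "linear (\<lambda>v. form v w)" "linear (form w)" for w
      using bilinear_form by (auto simp: bilinear_def)
    have fin: "finite (N \<union> P)" using NP by simp
    have "u \<in> span (N \<union> P)" using NP(5) by simp
    then obtain c where c: "u = (\<Sum>b\<in>N \<union> P. c b *\<^sub>R b)"
      unfolding span_finite[OF fin] by auto
    have coeff: "form u d = c d * form d d" if d: "d \<in> N \<union> P" for d
    proof -
      have "form u d = (\<Sum>b\<in>N \<union> P. c b * form b d)"
        by (subst c) (simp add: linear_sum[OF lin(1)] form_simps)
      also have "\<dots> = (\<Sum>b\<in>N \<union> P. if b = d then c d * form d d else 0)"
        by (rule sum.cong) (use NP(8) d in auto)
      also have "\<dots> = c d * form d d" using fin d by simp
      finally show ?thesis .
    qed
    have cN: "c b = 0" if "b \<in> N" for b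
    proof -
      have "form u b = 0" using that u N by auto
      then show ?thesis using coeff[of b] that NP(6) by auto
    qed
    have "form u u = (\<Sum>b\<in>N \<union> P. c b * form u b)"
      by (subst (2) c) (simp add: linear_sum[OF lin(2)] form_simps)
    also have "\<dots> = (\<Sum>b\<in>N \<union> P. (c b)\<^sup>2)"
      by (rule sum.cong) (use coeff cN NP(7) in \<open>auto simp: power2_eq_square\<close>)
    finally have "(\<Sum>b\<in>N \<union> P. (c b)\<^sup>2) = 0" using u by simp
    then have "\<forall>b\<in>N \<union> P. c b = 0" using fin by (simp add: sum_nonneg_eq_0_iff)
    then show "u = 0" by (simp add: c)
  qed
  then show ?thesis using that by blast
qed

text \<open>By the preceding lemma, pairing with the two negative basis vectors embeds any isotropic
  subspace into \<open>\<real>\<^sup>2\<close>. The coefficients come from Cramer's rule there.\<close>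

lemma isotropic_three_dependent:
  assumes sig: "has_signature form 2 q"
    and orth: "form u u = 0" "form v v = 0" "form w w = 0" "form u v = 0" "form u w = 0" "form v w = 0"
    and u: "u \<noteq> 0" and v: "\<And>c. v \<noteq> c *\<^sub>R u"
  shows "\<exists>\<alpha> \<beta>. w = \<alpha> *\<^sub>R u + \<beta> *\<^sub>R v"
proof -
  obtain n\<^sub>1 n\<^sub>2
    where inj: "\<And>x. form x n\<^sub>1 = 0 \<Longrightarrow> form x n\<^sub>2 = 0 \<Longrightarrow> form x x = 0 \<Longrightarrow> x = 0"
    using signature_two_negative_directions[OF sig] by blast
  have sym: "form v u = 0" "form w u = 0" "form w v = 0" using orth sym_form by metis+
  define D where "D = form u n\<^sub>1 * form v n\<^sub>2 - form u n\<^sub>2 * form v n\<^sub>1"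
  have D: "D \<noteq> 0"
  proof
    assume D: "D = 0"
    have 1: "form u n\<^sub>1 *\<^sub>R v - form v n\<^sub>1 *\<^sub>R u = 0"
      by (rule inj) (use D in \<open>simp_all add: form_simps orth sym D_def algebra_simps\<close>)
    have 2: "form u n\<^sub>2 *\<^sub>R v - form v n\<^sub>2 *\<^sub>R u = 0"
      by (rule inj) (use D in \<open>simp_all add: form_simps orth sym D_def algebra_simps\<close>)
    have no: "s = 0" if "s *\<^sub>R v - t *\<^sub>R u = 0" for s t :: real
    proof (rule ccontr)
      assume "s \<noteq> 0"
      then have "v = (1 / s) *\<^sub>R (s *\<^sub>R v)" by simp
      also have "\<dots> = (t / s) *\<^sub>R u" using that by simp
      finally show False using v by blast
    qed
    show False using no[OF 1] no[OF 2] inj orth u by blast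
  qed
  define \<alpha> where "\<alpha> = (form w n\<^sub>1 * form v n\<^sub>2 - form w n\<^sub>2 * form v n\<^sub>1) / D"
  define \<beta> where "\<beta> = (form u n\<^sub>1 * form w n\<^sub>2 - form u n\<^sub>2 * form w n\<^sub>1) / D"
  have c1: "form w n\<^sub>1 = \<alpha> * form u n\<^sub>1 + \<beta> * form v n\<^sub>1"
    using D by (simp add: \<alpha>_def \<beta>_def field_simps) (simp add: D_def algebra_simps)
  have c2: "form w n\<^sub>2 = \<alpha> * form u n\<^sub>2 + \<beta> * form v n\<^sub>2"
    using D by (simp add: \<alpha>_def \<beta>_def field_simps) (simp add: D_def algebra_simps)
  have "w - (\<alpha> *\<^sub>R u + \<beta> *\<^sub>R v) = 0"
    by (rule inj) (simp_all add: form_simps orth sym c1 c2)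
  then show ?thesis by (metis eq_iff_diff_eq_0)
qed


section \<open>The Levi-Civita product\<close>

abbreviation lc_product (infixl "\<cdot>" 80) where
  "u \<cdot> v \<equiv> levi_civita br form u v"

lemma br_anticommute: "br v u = - br u v"
proof -
  have "br u v + br v u = 0"
    using alternating[of "u + v"] unfolding br_simps by (simp add: alternating add.commute)
  then show ?thesis by (simp add: eq_neg_iff_add_eq_0 add.commute)
qed

lemma product_skew: "form (u \<cdot> v) w = - form v (u \<cdot> w)"
proof -
  have "2 * form (u \<cdot> v) w + 2 * form (u \<cdot> w) v = 0"
    unfolding levi_civita_eq
    by (simp add: br_anticommute[of u w] br_anticommute[of u v] br_anticommute[of v w] form_simps)
  then show ?thesis using sym_form[of v] by simp
qed

lemma br_eq_product: "br u v = u \<cdot> v - v \<cdot> u"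
proof (rule eq_by_form)
  fix w
  have "2 * form (u \<cdot> v) w - 2 * form (v \<cdot> u) w = 2 * form (br u v) w"
    unfolding levi_civita_eq
    by (simp add: br_anticommute[of u v] form_simps)
  then show "form (br u v) w = form (u \<cdot> v - v \<cdot> u) w" by (simp add: form_simps)
qed

lemma bilinear_product: "bilinear (\<cdot>)"
proof -
  have "(u + v) \<cdot> w = u \<cdot> w + v \<cdot> w" for u v w
  proof (rule eq_by_form)
    fix x
    have "2 * form ((u + v) \<cdot> w) x = 2 * form (u \<cdot> w) x + 2 * form (v \<cdot> w) x"
      unfolding levi_civita_eq by (simp add: form_simps br_simps)
    then show "form ((u + v) \<cdot> w) x = form (u \<cdot> w + v \<cdot> w) x" by (simp add: form_simps)
  qed
  moreover have "(c *\<^sub>R u) \<cdot> w = c *\<^sub>R (u \<cdot> w)" for c u w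
  proof (rule eq_by_form)
    fix x
    have "2 * form ((c *\<^sub>R u) \<cdot> w) x = c * (2 * form (u \<cdot> w) x)"
      unfolding levi_civita_eq by (simp add: form_simps br_simps algebra_simps)
    then show "form ((c *\<^sub>R u) \<cdot> w) x = form (c *\<^sub>R (u \<cdot> w)) x" by (simp add: form_simps)
  qed
  moreover have "u \<cdot> (v + w) = u \<cdot> v + u \<cdot> w" for u v w
    by (rule eq_by_form) (simp add: form_simps product_skew)
  moreover have "u \<cdot> (c *\<^sub>R v) = c *\<^sub>R (u \<cdot> v)" for c u v
    by (rule eq_by_form) (simp add: form_simps product_skew)
  ultimately show ?thesis unfolding bilinear_def by (auto intro!: linearI)
qed

lemmas product_simps =
  bilinear_ladd[OF bilinear_product] bilinear_radd[OF bilinear_product]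
  bilinear_lsub[OF bilinear_product] bilinear_rsub[OF bilinear_product]
  bilinear_lneg[OF bilinear_product] bilinear_rneg[OF bilinear_product]
  bilinear_lmul[OF bilinear_product] bilinear_rmul[OF bilinear_product]
  bilinear_lzero[OF bilinear_product] bilinear_rzero[OF bilinear_product]

lemma center_product_form:
  assumes "z \<in> lie_center br"
  shows "2 * form (z \<cdot> v) w = form (br w v) z"
proof -
  have "br z v = 0" "br w z = 0"
    using assms br_anticommute[of z w] by (auto simp: lie_center_def)
  then show ?thesis unfolding levi_civita_eq by (simp add: form_simps)
qed

lemma center_product_commute:
  assumes "z \<in> lie_center br"
  shows "u \<cdot> z = z \<cdot> u"
  using assms br_eq_product[of z u] by (simp add: lie_center_def)

lemma center_product_center:
  assumes "z \<in> lie_center br" "z' \<in> lie_center br"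
  shows "z \<cdot> z' = 0"
proof (rule eq_by_form)
  fix w
  have "br w z' = 0" using assms(2) br_anticommute[of z' w] by (simp add: lie_center_def)
  then show "form (z \<cdot> z') w = form 0 w"
    using center_product_form[OF assms(1), of z' w] by (simp add: form_simps)
qed

lemma degenerate_centerI:
  assumes "w \<in> lie_center br" "w \<noteq> 0" "\<And>z. z \<in> lie_center br \<Longrightarrow> form w z = 0"
  shows "degenerate_subspace form (lie_center br)"
  using assms unfolding degenerate_subspace_def form_perp_def by blast

lemma ad_nilpotent:
  assumes "lie_nilpotent br"
  obtains k where "\<And>x y. (br x ^^ k) y = 0"
proof -
  obtain k where k: "lower_central_series br k = {0}"
    using assms unfolding lie_nilpotent_def by blast
  have "(br x ^^ i) y \<in> lower_central_series br i" for x y i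
    by (induction i) (auto intro: span_base)
  then show ?thesis using that[of k] k by blast
qed

text \<open>By \<open>center_product_form\<close> the hypothesis makes all brackets orthogonal to the center. The last
  nonzero term of the lower central series is central and, since the algebra is not abelian, it is
  spanned by brackets.\<close>

lemma degenerate_if_center_acts_trivially:
  assumes nil: "lie_nilpotent br" and nonab: "\<not> lie_abelian br"
    and triv: "\<And>z u. z \<in> lie_center br \<Longrightarrow> z \<cdot> u = 0"
  shows "degenerate_subspace form (lie_center br)"
proof -
  let ?C = "lower_central_series br"
  define k where "k = (LEAST k. ?C k = {0})"
  have k: "?C k = {0}"
    using nil LeastI_ex unfolding lie_nilpotent_def k_def by fast
  have "k \<noteq> 0" using k nonab unfolding lie_abelian_def by fastforce
  then obtain j where j: "k = Suc j" using not0_implies_Suc by blast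
  have central: "v \<in> lie_center br" if "v \<in> ?C j" for v
  proof -
    have "br u v \<in> ?C k" for u unfolding j using that by (auto intro: span_base)
    then have "br u v = 0" for u using k by blast
    then have "br v u = 0" for u by (metis br_anticommute neg_equal_0_iff_equal)
    then show ?thesis by (simp add: lie_center_def)
  qed
  \<comment> \<open>The first term of the series is the whole algebra, which is not central.\<close>
  have "j \<noteq> 0"
    by (rule notI, use central nonab in \<open>auto simp: lie_center_def lie_abelian_def\<close>)
  then obtain i where i: "j = Suc i" using not0_implies_Suc by blast
  have "?C j \<noteq> {0}" using not_less_Least[of j "\<lambda>k. ?C k = {0}"] j unfolding k_def by simp
  moreover have "0 \<in> ?C j" unfolding i by (simp add: span_zero)
  ultimately obtain v where v: "v \<in> ?C j" "v \<noteq> 0" by blast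
  show ?thesis
  proof (rule degenerate_centerI)
    show "v \<in> lie_center br" "v \<noteq> 0" using v central by auto
    fix z assume z: "z \<in> lie_center br"
    have "linear (\<lambda>u. form u z)" using bilinear_form by (auto simp: bilinear_def)
    moreover have "form b z = 0" if b: "b \<in> {br u v | u v. v \<in> ?C i}" for b
    proof -
      obtain u v where "b = br u v" using b by blast
      then show ?thesis
        using center_product_form[OF z, of v u] triv[OF z] by (simp add: form_simps)
    qed
    ultimately show "form v z = 0"
      using linear_eq_0_on_span[of "\<lambda>u. form u z" _ v] v(1)
      unfolding i lower_central_series.simps by blast
  qed
qed

end


section \<open>The plane of a central element\<close>

locale flat_central_plane = pseudo_euclidean_lie_algebra br form
  for br :: "'a::real_vector \<Rightarrow> 'a \<Rightarrow> 'a" and form :: "'a \<Rightarrow> 'a \<Rightarrow> real" +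
  fixes z :: 'a and q :: nat
  assumes flat: "flat br form"
    and nilpotent: "lie_nilpotent br"
    and signature: "has_signature form 2 q"
    and z_central: "z \<in> lie_center br"
    and z_acts: "\<exists>a. z \<cdot> a \<noteq> 0"
begin

definition W :: "'a set" where "W = range ((\<cdot>) z)"

text \<open>Since left multiplication by \<open>z\<close> is skew, its kernel is the orthogonal of its image \<open>W\<close>.\<close>

definition K :: "'a set" where "K = {x. z \<cdot> x = 0}"

lemma left_symmetric: "u \<cdot> v \<cdot> w - u \<cdot> (v \<cdot> w) = v \<cdot> u \<cdot> w - v \<cdot> (u \<cdot> w)"
  using flat unfolding flat_def Let_def by blast

lemma product_br: "br u v \<cdot> w = u \<cdot> (v \<cdot> w) - v \<cdot> (u \<cdot> w)"
  using left_symmetric[of u v w] by (simp add: br_eq_product product_simps algebra_simps)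

lemma z_commute: "z \<cdot> (u \<cdot> v) = u \<cdot> (z \<cdot> v)"
  using product_br[of z u v] z_central by (simp add: lie_center_def product_simps)

lemma z_square_zero: "z \<cdot> (z \<cdot> u) = 0"
proof -
  have "z \<cdot> (z \<cdot> u) = z \<cdot> (u \<cdot> z)" by (simp add: center_product_commute[OF z_central])
  also have "\<dots> = u \<cdot> (z \<cdot> z)" by (rule z_commute)
  finally show ?thesis by (simp add: center_product_center[OF z_central z_central] product_simps)
qed

lemma W_subset_K: "W \<subseteq> K"
  by (auto simp: W_def K_def z_square_zero)

lemma W_orthogonal_K:
  assumes "w \<in> W" "x \<in> K"
  shows "form w x = 0"
  using assms product_skew by (auto simp: W_def K_def form_simps)

lemma W_orthogonal_W: "u \<in> W \<Longrightarrow> v \<in> W \<Longrightarrow> form u v = 0"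
  using W_orthogonal_K W_subset_K by blast

lemma W_orthogonal_center:
  assumes "w \<in> W" "c \<in> lie_center br"
  shows "form w c = 0"
  using assms product_skew center_product_center[OF z_central]
  by (auto simp: W_def form_simps)

lemma product_W: "w \<in> W \<Longrightarrow> u \<cdot> w \<in> W"
  unfolding W_def by (auto simp flip: z_commute)

lemma product_K: "x \<in> K \<Longrightarrow> u \<cdot> x \<in> K"
  by (simp add: K_def z_commute product_simps)

lemma subspace_W: "subspace W"
proof -
  have "linear ((\<cdot>) z)" using bilinear_product by (simp add: bilinear_def)
  then show ?thesis unfolding W_def using linear_subspace_image subspace_UNIV by blast
qed

lemma subspace_K: "subspace K"
  unfolding K_def subspace_def by (simp add: product_simps)

lemma planar_W: "planar W"
  unfolding planar_def
proof (intro ballI impI)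
  fix u v w
  assume "u \<in> W" "v \<in> W" "w \<in> W" "u \<noteq> 0" "\<forall>c. v \<noteq> c *\<^sub>R u"
  then show "\<exists>\<alpha> \<beta>. w = \<alpha> *\<^sub>R u + \<beta> *\<^sub>R v"
    by (intro isotropic_three_dependent[OF signature]) (simp_all add: W_orthogonal_W)
qed

text \<open>The scalar \<open>\<langle>z \<cdot> a, b\<rangle>\<close> is the value of a symplectic form on the plane \<open>W\<close>, given by
  \<open>\<omega>(z \<cdot> u, z \<cdot> v) = \<langle>z \<cdot> u, v\<rangle>\<close>. It is invariant under all left multiplications.\<close>

lemma W_basis:
  obtains a b where "form (z \<cdot> a) b \<noteq> 0"
    "\<And>w. w \<in> W \<Longrightarrow> \<exists>\<alpha> \<beta>. w = \<alpha> *\<^sub>R z \<cdot> a + \<beta> *\<^sub>R z \<cdot> b"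
    "z \<cdot> a \<noteq> 0" "\<And>c. z \<cdot> b \<noteq> c *\<^sub>R z \<cdot> a"
proof -
  obtain a where a: "z \<cdot> a \<noteq> 0" using z_acts by blast
  then obtain b where b: "form (z \<cdot> a) b \<noteq> 0"
    using nondegenerate_form unfolding nondegenerate_def by blast
  have ind: "z \<cdot> b \<noteq> c *\<^sub>R z \<cdot> a" for c
  proof
    assume *: "z \<cdot> b = c *\<^sub>R z \<cdot> a"
    have "form (z \<cdot> a) a = 0" using product_skew[of z a a] sym_form[of a] by simp
    then have "form (z \<cdot> b) a = 0" by (simp add: * form_simps)
    then show False using b product_skew[of z a b] sym_form[of a] by simp
  qed
  have "z \<cdot> a \<in> W" "z \<cdot> b \<in> W" by (auto simp: W_def)
  then have "\<exists>\<alpha> \<beta>. w = \<alpha> *\<^sub>R z \<cdot> a + \<beta> *\<^sub>R z \<cdot> b" if "w \<in> W" for w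
    using planar_combination[OF planar_W _ _ a ind that] by metis
  then show ?thesis using that a b ind by blast
qed

text \<open>Otherwise \<open>W\<close> and \<open>x\<close> would span a three-dimensional isotropic subspace. In other words, the
  form is definite on \<open>K / W\<close>.\<close>

lemma isotropic_in_K:
  assumes "x \<in> K" "form x x = 0"
  shows "x \<in> W"
proof -
  obtain a b where ab: "z \<cdot> a \<noteq> 0" "\<And>c. z \<cdot> b \<noteq> c *\<^sub>R z \<cdot> a" using W_basis by metis
  have W: "z \<cdot> a \<in> W" "z \<cdot> b \<in> W" by (auto simp: W_def)
  then have "\<exists>\<alpha> \<beta>. x = \<alpha> *\<^sub>R z \<cdot> a + \<beta> *\<^sub>R z \<cdot> b"
    by (intro isotropic_three_dependent[OF signature])
      (use assms ab in \<open>simp_all add: W_orthogonal_W W_orthogonal_K\<close>)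
  then obtain \<alpha> \<beta> where "x = \<alpha> *\<^sub>R z \<cdot> a + \<beta> *\<^sub>R z \<cdot> b" by blast
  then show ?thesis using W subspace_W by (simp add: subspace_add subspace_scale)
qed


section \<open>Nilpotency of left multiplications on the plane\<close>

text \<open>Invariance of the symplectic form \<open>\<omega>\<close> makes the restriction of every left multiplication to \<open>W\<close>
  a traceless \<open>2 \<times> 2\<close> matrix, whose square is a scalar by the Cayley-Hamilton theorem.\<close>

lemma product_square_scalar_on_W:
  obtains \<delta> where "\<And>w. w \<in> W \<Longrightarrow> x \<cdot> (x \<cdot> w) = \<delta> *\<^sub>R w"
proof -
  obtain a b where k: "form (z \<cdot> a) b \<noteq> 0"
    and span: "\<And>w. w \<in> W \<Longrightarrow> \<exists>\<alpha> \<beta>. w = \<alpha> *\<^sub>R z \<cdot> a + \<beta> *\<^sub>R z \<cdot> b"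
    using W_basis by metis
  have W: "z \<cdot> a \<in> W" "z \<cdot> b \<in> W" by (auto simp: W_def)
  obtain \<alpha> \<beta> where a: "x \<cdot> (z \<cdot> a) = \<alpha> *\<^sub>R z \<cdot> a + \<beta> *\<^sub>R z \<cdot> b"
    using span product_W W by blast
  obtain \<gamma> \<eta> where b: "x \<cdot> (z \<cdot> b) = \<gamma> *\<^sub>R z \<cdot> a + \<eta> *\<^sub>R z \<cdot> b"
    using span product_W W by blast
  have null: "form (z \<cdot> u) u = 0" for u using product_skew[of z u u] sym_form[of u] by simp
  have "form (x \<cdot> (z \<cdot> a)) b = - form (z \<cdot> a) (x \<cdot> b)" by (rule product_skew)
  also have "\<dots> = form a (x \<cdot> (z \<cdot> b))" by (simp add: product_skew z_commute)
  also have "\<dots> = - \<eta> * form (z \<cdot> a) b"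
    using null[of a] sym_form[of a "z \<cdot> a"] product_skew[of z a b] by (simp add: b form_simps)
  finally have "\<alpha> * form (z \<cdot> a) b = - \<eta> * form (z \<cdot> a) b"
    by (simp add: a form_simps null)
  then have "(\<eta> + \<alpha>) * form (z \<cdot> a) b = 0" by (simp add: distrib_right)
  then have \<eta>: "\<eta> = - \<alpha>" using k by (simp add: eq_neg_iff_add_eq_0)
  have "x \<cdot> (x \<cdot> w) = (\<alpha> * \<alpha> + \<beta> * \<gamma>) *\<^sub>R w" if w: "w \<in> W" for w
  proof -
    obtain s t where "w = s *\<^sub>R z \<cdot> a + t *\<^sub>R z \<cdot> b" using span w by blast
    then show ?thesis by (simp add: product_simps a b \<eta> algebra_simps)
  qed
  then show ?thesis using that by blast
qed

text \<open>The identity is not traceless; \<open>\<omega>\<close> detects this again.\<close>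

lemma product_not_identity_on_W: "\<exists>w\<in>W. x \<cdot> w \<noteq> w"
proof (rule ccontr)
  assume "\<not> ?thesis"
  then have id: "x \<cdot> (z \<cdot> u) = z \<cdot> u" for u by (auto simp: W_def)
  obtain a b where k: "form (z \<cdot> a) b \<noteq> 0" using W_basis by metis
  have "form (x \<cdot> (z \<cdot> a)) b = - form (z \<cdot> a) (x \<cdot> b)" by (rule product_skew)
  also have "\<dots> = form a (x \<cdot> (z \<cdot> b))" by (simp add: product_skew z_commute)
  also have "\<dots> = - form (z \<cdot> a) b" by (simp add: id product_skew)
  finally show False using k by (simp add: id)
qed

text \<open>Let the square of \<open>x\<close> on \<open>W\<close> be the scalar \<open>\<delta> \<noteq> 0\<close>. The map \<open>y \<mapsto> z \<cdot> y\<close> is a 1-cocycle with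
  values in \<open>W\<close>, and subtracting the coboundary of \<open>p\<close>, chosen by \<open>x \<cdot> p = z \<cdot> x\<close>, gives a cocycle \<open>d\<close>
  with \<open>d [x, y] = x \<cdot> d y\<close>. As \<open>ad x\<close> is nilpotent and \<open>x\<close> is invertible on \<open>W\<close>, \<open>d\<close> vanishes,
  that is, \<open>z \<cdot> y = y \<cdot> p\<close> for all \<open>y\<close>. Now \<open>p = z \<cdot> r\<close> for some \<open>r\<close>, which fixes \<open>p\<close> and so has
  eigenvalues \<open>1\<close> and \<open>-1\<close> on \<open>W\<close>. This forces \<open>ad r\<close> to have the eigenvalue \<open>-2\<close> modulo
  \<open>K\<close>, contrary to nilpotency.\<close>

lemma product_square_zero_on_W:
  assumes w: "w \<in> W"
  shows "x \<cdot> (x \<cdot> w) = 0"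
proof -
  obtain k where ad: "\<And>u v. (br u ^^ k) v = 0" using ad_nilpotent[OF nilpotent] by blast
  obtain \<delta> where \<delta>: "\<And>w. w \<in> W \<Longrightarrow> x \<cdot> (x \<cdot> w) = \<delta> *\<^sub>R w"
    using product_square_scalar_on_W by blast
  have "\<delta> = 0"
  proof (rule ccontr)
    assume \<delta>0: "\<delta> \<noteq> 0"
    have zW: "z \<cdot> y \<in> W" for y by (auto simp: W_def)
    define p where "p = (1 / \<delta>) *\<^sub>R x \<cdot> (z \<cdot> x)"
    have pW: "p \<in> W"
      unfolding p_def by (rule subspace_scale[OF subspace_W product_W[OF zW]])
    have xp: "x \<cdot> p = z \<cdot> x" by (simp add: p_def product_simps \<delta>[OF zW] \<delta>0)
    define d where "d y = z \<cdot> y - y \<cdot> p" for y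
    have d_br: "d (br y v) = y \<cdot> d v - v \<cdot> d y" for y v
      using product_br[of y v p]
      by (simp add: d_def br_eq_product product_simps z_commute center_product_commute[OF z_central])
    have dW: "d y \<in> W" for y
      unfolding d_def by (rule subspace_diff[OF subspace_W zW product_W[OF pW]])
    have dx: "d x = 0" by (simp add: d_def xp)
    have "d y = 0" for y
    proof -
      have "((\<cdot>) x ^^ i) (d y) = d ((br x ^^ i) y)" for i
        by (induction i) (simp_all add: d_br dx product_simps)
      moreover have "d 0 = 0" by (simp add: d_def product_simps)
      ultimately have nil: "((\<cdot>) x ^^ k) (d y) = 0" by (simp add: ad)
      have "x \<cdot> (x \<cdot> d y) = 0"
        by (rule nilpotent_on_plane_square_zero[OF planar_W _ product_W nil dW])
          (use bilinear_product in \<open>simp_all add: bilinear_def\<close>)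
      then show "d y = 0" using \<delta>[OF dW] \<delta>0 by simp
    qed
    then have zp: "z \<cdot> y = y \<cdot> p" for y by (simp add: d_def)
    have p0: "p \<noteq> 0" using z_acts zp by (auto simp: product_simps)
    obtain r where r: "z \<cdot> r = p" using pW by (auto simp: W_def)
    have rp: "r \<cdot> p = p" using zp[of r] r by simp
    obtain \<rho> where \<rho>: "\<And>w. w \<in> W \<Longrightarrow> r \<cdot> (r \<cdot> w) = \<rho> *\<^sub>R w"
      using product_square_scalar_on_W by blast
    have "\<rho> = 1" using \<rho>[OF pW] p0 by (metis rp scaleR_one scaleR_right_imp_eq)
    then have invol: "r \<cdot> (r \<cdot> w) = w" if "w \<in> W" for w using \<rho>[OF that] by simp
    obtain u where u: "u \<in> W" "r \<cdot> u \<noteq> u" using product_not_identity_on_W by blast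
    \<comment> \<open>The projection of \<open>u\<close> to the eigenspace of \<open>-1\<close>, up to a factor of two.\<close>
    define v where "v = u - r \<cdot> u"
    have v: "v \<in> W" "v \<noteq> 0" "r \<cdot> v = - v"
      using u invol[OF u(1)]
      by (auto simp: v_def product_simps intro: subspace_diff[OF subspace_W] product_W)
    obtain y where y: "z \<cdot> y = v" using v(1) by (auto simp: W_def)
    have step: "z \<cdot> br r t = r \<cdot> (z \<cdot> t) - z \<cdot> t" for t
      using zp[of t] by (simp add: br_eq_product product_simps z_commute r)
    have "z \<cdot> (br r ^^ i) y = (-2) ^ i *\<^sub>R v" for i
    proof (induction i)
      case (Suc i)
      then have "z \<cdot> (br r ^^ Suc i) y = (-2) ^ i *\<^sub>R (- v) - (-2) ^ i *\<^sub>R v"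
        by (simp add: step product_simps v(3))
      also have "\<dots> = (-2) ^ Suc i *\<^sub>R v"
        by (simp add: algebra_simps flip: scaleR_left_distrib)
      finally show ?case .
    qed (simp add: y)
    from this[of k] show False using v(2) by (simp add: ad product_simps)
  qed
  then show ?thesis using \<delta>[OF w] by simp
qed

lemma right_annihilator_in_W:
  "\<exists>e\<in>W. e \<noteq> 0 \<and> (\<forall>x. x \<cdot> e = 0) \<and> (\<forall>x. \<forall>w\<in>W. \<exists>c. x \<cdot> w = c *\<^sub>R e)"
proof -
  obtain a where a: "z \<cdot> a \<noteq> 0" using z_acts by blast
  have zW: "z \<cdot> a \<in> W" by (simp add: W_def)
  have "\<exists>e\<in>W. e \<noteq> 0 \<and> (\<forall>x\<in>UNIV. x \<cdot> e = 0) \<and> (\<forall>x\<in>UNIV. \<forall>w\<in>W. \<exists>c. x \<cdot> w = c *\<^sub>R e)"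
    by (rule common_kernel_on_plane[OF planar_W zW a UNIV_I bilinear_product product_W product_square_zero_on_W])
  then show ?thesis by simp
qed


section \<open>The plane as an ideal of its orthogonal\<close>

text \<open>On \<open>K\<close>, left multiplication by \<open>w \<in> W\<close> agrees with \<open>ad w\<close> modulo \<open>W\<close>, so it is nilpotent on
  \<open>K / W\<close>. It is also skew for the form induced there, which is definite by \<open>isotropic_in_K\<close>, hence
  it is zero.\<close>

lemma product_W_K:
  assumes w: "w \<in> W" and x: "x \<in> K"
  shows "w \<cdot> x \<in> W"
proof -
  obtain k where ad: "\<And>u v. (br u ^^ k) v = 0" using ad_nilpotent[OF nilpotent] by blast
  have LK: "((\<cdot>) w ^^ i) x \<in> K" for i by (induction i) (auto simp: x product_K)
  have "((\<cdot>) w ^^ i) x - (br w ^^ i) x \<in> W" for i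
  proof (induction i)
    case 0
    show ?case using subspace_0[OF subspace_W] by simp
  next
    case (Suc i)
    have "((\<cdot>) w ^^ Suc i) x - (br w ^^ Suc i) x =
        w \<cdot> (((\<cdot>) w ^^ i) x - (br w ^^ i) x) + (br w ^^ i) x \<cdot> w"
      by (simp add: br_eq_product product_simps)
    then show ?case by (simp add: subspace_add[OF subspace_W] product_W Suc w)
  qed
  from this[of k] have kW: "((\<cdot>) w ^^ k) x \<in> W" by (simp add: ad)
  have down: "((\<cdot>) w ^^ Suc i) x \<in> W" if "((\<cdot>) w ^^ Suc (Suc i)) x \<in> W" for i
  proof (rule isotropic_in_K[OF LK])
    let ?y = "((\<cdot>) w ^^ i) x"
    have "form (w \<cdot> ?y) (w \<cdot> ?y) = - form (w \<cdot> (w \<cdot> ?y)) ?y"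
      using product_skew[of w ?y "w \<cdot> ?y"] sym_form by simp
    also have "\<dots> = 0" using W_orthogonal_K[OF _ LK] that by simp
    finally show "form (((\<cdot>) w ^^ Suc i) x) (((\<cdot>) w ^^ Suc i) x) = 0" by simp
  qed
  have "((\<cdot>) w ^^ Suc i) x \<in> W \<Longrightarrow> w \<cdot> x \<in> W" for i
    by (induction i) (use down in auto)
  moreover have "((\<cdot>) w ^^ Suc k) x \<in> W" using kW by (simp add: product_W)
  ultimately show ?thesis by blast
qed

lemma ideal_line_in_W:
  "\<exists>f\<in>W. f \<noteq> 0 \<and> (\<forall>x\<in>K. br x f = 0) \<and> (\<forall>x\<in>K. \<forall>w\<in>W. \<exists>c. br x w = c *\<^sub>R f)"
proof -
  obtain a where a: "z \<cdot> a \<noteq> 0" using z_acts by blast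
  obtain k where ad: "\<And>u v. (br u ^^ k) v = 0" using ad_nilpotent[OF nilpotent] by blast
  have brW: "br x w \<in> W" if "x \<in> K" "w \<in> W" for x w
    using subspace_diff[OF subspace_W product_W[OF that(2)] product_W_K[OF that(2,1)]]
    by (simp add: br_eq_product)
  have sq: "br x (br x w) = 0" if "x \<in> K" "w \<in> W" for x w
    by (rule nilpotent_on_plane_square_zero[OF planar_W _ brW[OF that(1)] ad that(2)])
      (use bilinear_br in \<open>simp_all add: bilinear_def\<close>)
  have zW: "z \<cdot> a \<in> W" by (simp add: W_def)
  show ?thesis
    by (rule common_kernel_on_plane[OF planar_W zW a subspace_add[OF subspace_K] bilinear_br brW sq])
qed

text \<open>Let \<open>e\<close> span the line in \<open>W\<close> killed by all left multiplications and \<open>f\<close> the line killed by the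
  adjoint action of \<open>K\<close>. If the lines coincide, \<open>f\<close> has the property sought. Otherwise, for \<open>x \<in> K\<close>, the
  vector \<open>e \<cdot> x\<close> is a multiple \<open>s f\<close>, while \<open>f \<cdot> x = x \<cdot> f\<close> is a multiple \<open>t e\<close>. Left multiplication
  by \<open>e\<close> is a derivation, so \<open>e \<cdot> (x \<cdot> x) = 2 s t e\<close>; but this lies on the line of \<open>f\<close>, hence
  \<open>s t = 0\<close>. As \<open>s\<close> and \<open>t\<close> are linear in \<open>x\<close>, one of them is identically zero.\<close>

lemma annihilates_K_in_W:
  "\<exists>g\<in>W. g \<noteq> 0 \<and> (\<forall>x\<in>K. g \<cdot> x = 0)"
proof -
  obtain e where e: "e \<in> W" "e \<noteq> 0" "\<And>x. x \<cdot> e = 0"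
    and We: "\<And>x w. w \<in> W \<Longrightarrow> \<exists>c. x \<cdot> w = c *\<^sub>R e"
    using right_annihilator_in_W by blast
  obtain f where f: "f \<in> W" "f \<noteq> 0" "\<And>x. x \<in> K \<Longrightarrow> br x f = 0"
    and Kf: "\<And>x w. x \<in> K \<Longrightarrow> w \<in> W \<Longrightarrow> \<exists>c. br x w = c *\<^sub>R f"
    using ideal_line_in_W by blast
  have ex: "\<exists>c. e \<cdot> x = c *\<^sub>R f" if x: "x \<in> K" for x
  proof -
    obtain c where "br x e = c *\<^sub>R f" using Kf[OF x e(1)] by blast
    then have "e \<cdot> x = (- c) *\<^sub>R f" using br_eq_product[of x e] e(3)[of x] by (simp add: minus_equation_iff)
    then show ?thesis ..
  qed
  have fx: "f \<cdot> x = x \<cdot> f" if "x \<in> K" for x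
    using f(3)[OF that] by (simp add: br_eq_product)
  have deriv: "e \<cdot> (x \<cdot> x) = (e \<cdot> x) \<cdot> x + x \<cdot> (e \<cdot> x)" for x
    using left_symmetric[of e x x] e(3)[of x] by (simp add: product_simps algebra_simps)
  show ?thesis
  proof (cases "\<exists>c. f = c *\<^sub>R e")
    case True
    then obtain c where c: "f = c *\<^sub>R e" by blast
    then have "f \<cdot> x = 0" if "x \<in> K" for x using fx[OF that] e(3) by (simp add: product_simps)
    then show ?thesis using f by blast
  next
    case False
    have alt: "e \<cdot> x = 0 \<or> f \<cdot> x = 0" if x: "x \<in> K" for x
    proof -
      obtain s where s: "e \<cdot> x = s *\<^sub>R f" using ex[OF x] by blast
      obtain t where t: "x \<cdot> f = t *\<^sub>R e" using We[OF f(1)] by blast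
      obtain c where "e \<cdot> (x \<cdot> x) = c *\<^sub>R f" using ex product_K[OF x] by blast
      then have eq: "(2 * (s * t)) *\<^sub>R e = c *\<^sub>R f"
        using deriv[of x] by (simp add: s t fx[OF x] product_simps flip: scaleR_left_distrib)
      have "c = 0"
      proof (rule ccontr)
        assume c: "c \<noteq> 0"
        then have "f = (1 / c) *\<^sub>R (c *\<^sub>R f)" by simp
        also have "\<dots> = (2 * (s * t) / c) *\<^sub>R e" by (simp flip: eq)
        finally show False using False by blast
      qed
      then have "s = 0 \<or> t = 0" using eq e(2) by simp
      then show ?thesis using s t fx[OF x] by auto
    qed
    \<comment> \<open>\<open>K\<close> is not the union of two proper subspaces.\<close>
    have "(\<forall>x\<in>K. e \<cdot> x = 0) \<or> (\<forall>x\<in>K. f \<cdot> x = 0)"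
    proof (rule ccontr)
      assume "\<not> ?thesis"
      then obtain x y where xy: "x \<in> K" "e \<cdot> x \<noteq> 0" "y \<in> K" "f \<cdot> y \<noteq> 0" by blast
      then have "f \<cdot> x = 0" "e \<cdot> y = 0" using alt by blast+
      then show False
        using alt[OF subspace_add[OF subspace_K xy(1,3)]] xy by (simp add: product_simps)
    qed
    then show ?thesis using e f by blast
  qed
qed


section \<open>A central vector in the plane\<close>

text \<open>Left multiplication by \<open>g\<close> defines an alternating form \<open>\<langle>g \<cdot> u, v\<rangle>\<close> that descends to the
  quotient by \<open>K\<close>. This quotient has dimension two, so its alternating forms are all
  proportional.\<close>

lemma product_proportional_z:
  assumes g: "\<And>x. x \<in> K \<Longrightarrow> g \<cdot> x = 0"
  shows "\<exists>c. \<forall>u. g \<cdot> u = c *\<^sub>R z \<cdot> u"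
proof -
  obtain a b where k: "form (z \<cdot> a) b \<noteq> 0"
    and span: "\<And>w. w \<in> W \<Longrightarrow> \<exists>\<alpha> \<beta>. w = \<alpha> *\<^sub>R z \<cdot> a + \<beta> *\<^sub>R z \<cdot> b"
    using W_basis by metis
  have decomp: "\<exists>\<alpha> \<beta> x. x \<in> K \<and> u = \<alpha> *\<^sub>R a + \<beta> *\<^sub>R b + x" for u
  proof -
    obtain \<alpha> \<beta> where ab: "z \<cdot> u = \<alpha> *\<^sub>R z \<cdot> a + \<beta> *\<^sub>R z \<cdot> b" using span[of "z \<cdot> u"] by (auto simp: W_def)
    have "u - (\<alpha> *\<^sub>R a + \<beta> *\<^sub>R b) \<in> K" by (simp add: K_def product_simps ab)
    then show ?thesis by (metis add.commute diff_add_cancel)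
  qed
  have eval: "form (h \<cdot> (\<alpha> *\<^sub>R a + \<beta> *\<^sub>R b + x)) (\<alpha>' *\<^sub>R a + \<beta>' *\<^sub>R b + x') =
      (\<alpha> * \<beta>' - \<beta> * \<alpha>') * form (h \<cdot> a) b"
    if h: "\<And>x. x \<in> K \<Longrightarrow> h \<cdot> x = 0" and x: "x \<in> K" "x' \<in> K" for h \<alpha> \<beta> x \<alpha>' \<beta>' x'
  proof -
    have null: "form (h \<cdot> u) u = 0" for u using product_skew[of h u u] sym_form[of u] by simp
    have "form (h \<cdot> b) a = - form (h \<cdot> a) b" using product_skew[of h b a] sym_form by simp
    moreover have "form (h \<cdot> u) x' = 0" for u using product_skew[of h u x'] h x(2) by (simp add: form_simps)
    ultimately show ?thesis
      by (simp add: form_simps product_simps h x null) (simp add: algebra_simps)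
  qed
  define c where "c = form (g \<cdot> a) b / form (z \<cdot> a) b"
  have c: "form (g \<cdot> a) b = c * form (z \<cdot> a) b" using k by (simp add: c_def)
  have "g \<cdot> u = c *\<^sub>R z \<cdot> u" for u
  proof (rule eq_by_form)
    fix v
    obtain \<alpha> \<beta> x where u: "x \<in> K" "u = \<alpha> *\<^sub>R a + \<beta> *\<^sub>R b + x" using decomp by blast
    obtain \<alpha>' \<beta>' x' where v: "x' \<in> K" "v = \<alpha>' *\<^sub>R a + \<beta>' *\<^sub>R b + x'" using decomp by blast
    have "form (g \<cdot> u) v = (\<alpha> * \<beta>' - \<beta> * \<alpha>') * form (g \<cdot> a) b"
      unfolding u(2) v(2) by (rule eval) (use g u v in auto)
    moreover have "form (z \<cdot> u) v = (\<alpha> * \<beta>' - \<beta> * \<alpha>') * form (z \<cdot> a) b"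
      unfolding u(2) v(2) by (rule eval) (use u v in \<open>auto simp: K_def\<close>)
    ultimately show "form (g \<cdot> u) v = form (c *\<^sub>R z \<cdot> u) v" by (simp add: form_simps c)
  qed
  then show ?thesis by blast
qed

lemma centralI:
  assumes "\<And>x. w \<cdot> x = 0" "\<And>x. x \<cdot> w = 0"
  shows "w \<in> lie_center br"
  using assms by (simp add: lie_center_def br_eq_product)

text \<open>Here \<open>x \<cdot> w = [x, w]\<close>, and flatness turns brackets into commutators of left
  multiplications.\<close>

lemma left_annihilator_product:
  assumes "\<And>u. w \<cdot> u = 0"
  shows "x \<cdot> w \<cdot> u = 0"
proof -
  have "x \<cdot> w = br x w" using assms by (simp add: br_eq_product)
  then show ?thesis by (simp add: product_br assms product_simps)
qed

text \<open>If \<open>h\<close> itself is not central, some \<open>x \<cdot> h\<close> is nonzero. It lies on the line killed by all left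
  multiplications, and its own left multiplication is zero.\<close>

lemma central_vector_if_left_annihilator:
  assumes h: "h \<in> W" "h \<noteq> 0" "\<And>u. h \<cdot> u = 0"
  obtains w where "w \<in> W" "w \<noteq> 0" "w \<in> lie_center br"
proof (cases "\<forall>x. x \<cdot> h = 0")
  case True
  then show ?thesis using that h centralI by blast
next
  case False
  then obtain x where x: "x \<cdot> h \<noteq> 0" by blast
  obtain e where "e \<in> W" "e \<noteq> 0" and e: "\<And>x. x \<cdot> e = 0"
    and We: "\<And>x w. w \<in> W \<Longrightarrow> \<exists>c. x \<cdot> w = c *\<^sub>R e"
    using right_annihilator_in_W by blast
  obtain c where c: "x \<cdot> h = c *\<^sub>R e" using We h(1) by blast
  have "x \<cdot> h \<in> lie_center br"
    by (rule centralI) (rule left_annihilator_product[OF h(3)], simp add: c e product_simps)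
  then show ?thesis using that x product_W[OF h(1)] by blast
qed

text \<open>Left multiplication by \<open>[g, x]\<close> is a multiple of the commutator of those by \<open>z\<close> and \<open>x\<close>,
  which is zero.\<close>

lemma central_vector_in_W:
  obtains w where "w \<in> W" "w \<noteq> 0" "w \<in> lie_center br"
proof -
  obtain g where g: "g \<in> W" "g \<noteq> 0" "\<And>x. x \<in> K \<Longrightarrow> g \<cdot> x = 0"
    using annihilates_K_in_W by blast
  obtain c where "\<forall>u. g \<cdot> u = c *\<^sub>R z \<cdot> u" using product_proportional_z g(3) by blast
  then have c: "g \<cdot> u = c *\<^sub>R z \<cdot> u" for u by blast
  show ?thesis
  proof (cases "\<forall>x. br g x = 0")
    case True
    then have "g \<in> lie_center br" by (simp add: lie_center_def)
    with g(1,2) show ?thesis by (rule that)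
  next
    case False
    then obtain x where x: "br g x \<noteq> 0" by blast
    have "z \<cdot> x \<in> W" by (simp add: W_def)
    then have "c *\<^sub>R z \<cdot> x - x \<cdot> g \<in> W"
      using subspace_diff[OF subspace_W subspace_scale[OF subspace_W] product_W[OF g(1)]] by blast
    then have brW: "br g x \<in> W" using br_eq_product[of g x] c[of x] by simp
    have annih: "br g x \<cdot> u = 0" for u
      using product_br[of g x u] c z_commute[of x u] by (simp add: product_simps)
    obtain w where "w \<in> W" "w \<noteq> 0" "w \<in> lie_center br"
      by (rule central_vector_if_left_annihilator[OF brW x annih])
    then show ?thesis by (rule that)
  qed
qed

end


section \<open>Degeneracy of the center\<close>

theorem theorem3p1:
  fixes br :: "'a::real_vector \<Rightarrow> 'a \<Rightarrow> 'a"
    and form :: "'a \<Rightarrow> 'a \<Rightarrow> real"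
    and n :: nat
  assumes "pseudo_euclidean_lie_algebra br form"
    and "dim (UNIV :: 'a set) = n"
    and "n \<ge> 4"
    and "has_signature form 2 (n - 2)"
    and "flat br form"
    and "lie_nilpotent br"
    and "\<not> lie_abelian br"
  shows "degenerate_subspace form (lie_center br)"
proof -
  interpret pseudo_euclidean_lie_algebra br form by fact
  show ?thesis
  proof (cases "\<forall>z\<in>lie_center br. \<forall>u. z \<cdot> u = 0")
    case True
    then show ?thesis using degenerate_if_center_acts_trivially assms(6,7) by blast
  next
    case False
    then obtain z where z: "z \<in> lie_center br" "\<exists>a. z \<cdot> a \<noteq> 0" by blast
    interpret flat_central_plane br form z "n - 2"
      by unfold_locales (use assms z in auto)
    obtain w where "w \<in> W" "w \<noteq> 0" "w \<in> lie_center br" by (rule central_vector_in_W)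
    then show ?thesis using degenerate_centerI W_orthogonal_center by blast
  qed
qed

end
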